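(* Let $G$ be a connected graph and let $x,y\in V(G)$. Every shortest path between $x$ and $y$ in $G$ contains only edges from a single equivalence class of $\mathcal{C}_G$.
   Context: A quasi-transitive $2$-edge-colouring of a graph $G$ is a map $c: E(G)\to\{R,B\}$ such that for all pairs of edges $xy, yz \in E(G)$ with $c(xy)\neq c(yz)$, we have $xz\in E(G)$. $\mathcal{C}_G$ is the equivalence relation on $E(G)$ with $e\sim f$ iff $c(e)=c(f)$ for every quasi-transitive $2$-edge-colouring $c$ of $G$. *)

theory Defs
  imports Main
begin

definition simple_graph :: "'a set \<Rightarrow> 'a set set \<Rightarrow> bool" where
  "simple_graph V E \<longleftrightarrow> (\<forall>e\<in>E. \<exists>u\<in>V. \<exists>v\<in>V. u \<noteq> v \<and> e = {u, v})"

text \<open>Paths are given by their lists of vertices; a single vertex is a path without edges.\<close>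

definition path_edges :: "'a list \<Rightarrow> 'a set list" where
  "path_edges p = map (\<lambda>(u, v). {u, v}) (zip p (tl p))"

definition path_between :: "'a set \<Rightarrow> 'a set set \<Rightarrow> 'a \<Rightarrow> 'a \<Rightarrow> 'a list \<Rightarrow> bool" where
  "path_between V E x y p \<longleftrightarrow>
     p \<noteq> [] \<and> hd p = x \<and> last p = y \<and> distinct p \<and> set p \<subseteq> V \<and> set (path_edges p) \<subseteq> E"

definition connected_graph :: "'a set \<Rightarrow> 'a set set \<Rightarrow> bool" where
  "connected_graph V E \<longleftrightarrow>
     simple_graph V E \<and> V \<noteq> {} \<and> (\<forall>x\<in>V. \<forall>y\<in>V. \<exists>p. path_between V E x y p)"

definition shortest_path :: "'a set \<Rightarrow> 'a set set \<Rightarrow> 'a \<Rightarrow> 'a \<Rightarrow> 'a list \<Rightarrow> bool" where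
  "shortest_path V E x y p \<longleftrightarrow>
     path_between V E x y p \<and>
     (\<forall>q. path_between V E x y q \<longrightarrow> length (path_edges p) \<le> length (path_edges q))"

datatype colour = Red | Blue

text \<open>A colouring is a total function on vertex sets; only its values on \<open>E\<close> matter.\<close>

definition quasi_transitive_colouring :: "'a set set \<Rightarrow> ('a set \<Rightarrow> colour) \<Rightarrow> bool" where
  "quasi_transitive_colouring E c \<longleftrightarrow>
     (\<forall>x y z. {x, y} \<in> E \<and> {y, z} \<in> E \<and> c {x, y} \<noteq> c {y, z} \<longrightarrow> {x, z} \<in> E)"

definition colour_rel :: "'a set set \<Rightarrow> ('a set \<times> 'a set) set" where
  "colour_rel E =
     {(e, f). e \<in> E \<and> f \<in> E \<and> (\<forall>c. quasi_transitive_colouring E c \<longrightarrow> c e = c f)}"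

lemma equiv_colour_rel: "equiv E (colour_rel E)"
  by (rule equivI) (auto simp: colour_rel_def refl_on_def sym_def trans_def)

end

theory Submission
  imports Defs
begin

text \<open>
  A shortest path has no chord joining the two ends of a pair of consecutive edges, since such a
  chord would shorten it. Hence every quasi-transitive colouring gives consecutive edges of a
  shortest path the same colour, and so is constant on the path.
\<close>

lemma path_edges_Cons_Cons [simp]: "path_edges (u # v # p) = {u, v} # path_edges (v # p)"
  by (simp add: path_edges_def)

lemma path_edges_singleton [simp]: "path_edges [u] = []"
  by (simp add: path_edges_def)

lemma path_edges_Nil [simp]: "path_edges [] = []"
  by (simp add: path_edges_def)

lemma length_path_edges: "length (path_edges p) = length p - 1"
  by (simp add: path_edges_def)

text \<open>The cut vertex \<open>u\<close> is kept on both sides, so no edge at \<open>u\<close> is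
  lost.\<close>

lemma path_edges_append: "path_edges (xs @ u # ys) = path_edges (xs @ [u]) @ path_edges (u # ys)"
  by (induction xs rule: induct_list012) simp_all

lemma shortest_path_chordless:
  assumes "shortest_path V E x y (xs @ u # v # w # ys)"
  shows "{u, w} \<notin> E"
proof
  assume "{u, w} \<in> E"
  \<comment> \<open>Splitting both lists at \<open>u\<close> shows that only \<open>{u, v}\<close>
    and \<open>{v, w}\<close> give way to the chord; \<open>v\<close> is interior, so the ends
    survive.\<close>
  then have "path_between V E x y (xs @ u # w # ys)"
    using assms path_edges_append[of xs u "v # w # ys"] path_edges_append[of xs u "w # ys"]
    by (auto simp: shortest_path_def path_between_def hd_append split: if_splits)
  then have "length (path_edges (xs @ u # v # w # ys)) \<le> length (path_edges (xs @ u # w # ys))"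
    using assms by (simp add: shortest_path_def)
  \<comment> \<open>Both lists have at least two vertices, so the truncated subtraction in
    \<open>length_path_edges\<close> is exact and the new path is one edge shorter.\<close>
  then show False
    by (simp add: length_path_edges)
qed

text \<open>Chordlessness, unlike minimal length, passes to the tail of a path at once, which makes
  it a convenient hypothesis for induction on the list.\<close>

lemma quasi_transitive_colouring_chordless_path:
  assumes "quasi_transitive_colouring E c"
    and "set (path_edges p) \<subseteq> E"
    and "\<And>xs u v w ys. p = xs @ u # v # w # ys \<Longrightarrow> {u, w} \<notin> E"
    and "e \<in> set (path_edges p)"
  shows "c e = c (hd (path_edges p))"
  using assms(2-4)
proof (induction p rule: induct_list012)
  case (3 u v p)
  show ?case
  proof (cases p)
    case Nil
    then show ?thesis
      using "3.prems" by simp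
  next
    case (Cons w ys)
    have "{u, w} \<notin> E"
      using "3.prems"(2)[of "[]" u v w ys] Cons by simp
    moreover have "{u, v} \<in> E" "{v, w} \<in> E"
      using "3.prems"(1) Cons by auto
    ultimately have same: "c {u, v} = c {v, w}"
      using assms(1) unfolding quasi_transitive_colouring_def by blast
    \<comment> \<open>As \<open>p\<close> starts with \<open>w\<close>, the first edge of the tail
      \<open>v # p\<close> is \<open>{v, w}\<close>.\<close>
    have "c e = c {v, w}" if "e \<in> set (path_edges (v # p))"
    proof -
      have "{a, b} \<notin> E" if "v # p = xs @ a # m # b # zs" for xs a m b zs
        using "3.prems"(2)[of "u # xs" a m b zs] that by simp
      then show ?thesis
        using "3.IH"(2) "3.prems"(1) \<open>e \<in> set (path_edges (v # p))\<close> Cons by simp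
    qed
    then show ?thesis
      using "3.prems"(3) same by auto
  qed
qed simp_all

theorem theorem19:
  fixes V :: "'a set" and E :: "'a set set" and x y :: 'a
  assumes "connected_graph V E" and "x \<in> V" and "y \<in> V"
  shows "\<forall>p. shortest_path V E x y p \<longrightarrow>
           path_edges p = [] \<or> (\<exists>K \<in> E // colour_rel E. set (path_edges p) \<subseteq> K)"
proof (intro allI impI disjCI)
  fix p
  assume p: "shortest_path V E x y p"
    and no_class: "\<not> (\<exists>K \<in> E // colour_rel E. set (path_edges p) \<subseteq> K)"
  show "path_edges p = []"
  proof (rule ccontr)
    assume "path_edges p \<noteq> []"
    \<comment> \<open>The class of the first edge is the one that contains the whole path.\<close>
    define e where "e = hd (path_edges p)"
    have sub: "set (path_edges p) \<subseteq> E"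
      using p by (simp add: shortest_path_def path_between_def)
    then have "e \<in> E"
      using \<open>path_edges p \<noteq> []\<close> hd_in_set unfolding e_def by blast
    have "c f = c e" if "quasi_transitive_colouring E c" "f \<in> set (path_edges p)" for c f
      unfolding e_def using that sub p
      by (intro quasi_transitive_colouring_chordless_path) (auto dest: shortest_path_chordless)
    then have "set (path_edges p) \<subseteq> colour_rel E `` {e}"
      using sub \<open>e \<in> E\<close> by (force simp: colour_rel_def)
    with no_class quotientI[OF \<open>e \<in> E\<close>, of "colour_rel E"] show False
      by blast
  qed
qed

end
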